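(* Let $x=\cos\theta\in[-1,1]$, $|t|<\min\{(1-\beta^2)(1+\sqrt q|\beta|),1\}$, $\beta,\gamma\in(-1,1)\setminus\{0\}$, and $0<|q|<1$. Then $${}_2\phi_1\!\left(\beta^{1/2}e^{i\theta},-(q\beta)^{1/2}e^{i\theta};-\beta q^{1/2};q,te^{-i\theta}\right)\,{}_2\phi_1\!\left((q\beta)^{1/2}e^{-i\theta},-\beta^{1/2}e^{-i\theta};-\beta q^{1/2};q,te^{i\theta}\right)$$ $$=\sum_{n=0}^\infty\frac{(\pm\beta,\beta q^{1/2};q)_n\,t^n}{(\gamma,\beta^2,-\beta q^{1/2};q)_n}\,C_n(x;\gamma|q)\,\Phi_n,$$ where $\Phi_n$ is the series ${}_{10}\phi_9$ with base $q$, argument $\gamma t^2$, upper parameters $$\beta\gamma^{-1},\ \beta q^n,\ \pm i(\beta q^n)^{1/2},\ \pm i(\beta q^{n+1})^{1/2},\ \pm(\beta q^{n+1/2})^{1/2},\ \pm(\beta q^{n+3/2})^{1/2},$$ and lower parameters $$\gamma q^{n+1},\ \pm\beta q^{n/2},\ \pm\beta q^{(n+1)/2},\ \pm i(\beta q^{n+1/2})^{1/2},\ \pm i(\beta q^{n+3/2})^{1/2}.$$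
   Context: Notation: $(a;q)_0=1$, $(a;q)_n=\prod_{j=0}^{n-1}(1-aq^j)$, $(a;q)_\infty=\prod_{j\ge0}(1-aq^j)$, $(a_1,\dots,a_r;q)_n=\prod_i(a_i;q)_n$. In a list of parameters, $\pm a$ stands for the two entries $a,-a$. Square roots are taken consistently: $(q\beta)^{1/2}=q^{1/2}\beta^{1/2}$. The basic hypergeometric series, with upper parameters listed before the first semicolon and lower parameters before the second, is $${}_r\phi_s(a_1,\dots,a_r;b_1,\dots,b_s;q,z)=\sum_{k=0}^\infty\frac{(a_1,\dots,a_r;q)_k}{(q,b_1,\dots,b_s;q)_k}\left((-1)^kq^{\binom k2}\right)^{1+s-r}z^k.$$ The continuous $q$-ultraspherical/Rogers polynomials are, for $x=\cos\theta$, $$C_n(x;\beta|q)=\frac{(\beta;q)_n}{(q;q)_n}e^{in\theta}\,{}_2\phi_1\!\left(q^{-n},\beta;\beta^{-1}q^{1-n};q,q\beta^{-1}e^{-2i\theta}\right).$$ *)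

theory Defs
  imports Complex_Main
begin

definition qpoch :: "complex \<Rightarrow> complex \<Rightarrow> nat \<Rightarrow> complex" where
  "qpoch a q n = (\<Prod>j<n. 1 - a * q ^ j)"

definition qpochs :: "complex list \<Rightarrow> complex \<Rightarrow> nat \<Rightarrow> complex" where
  "qpochs as q n = (\<Prod>a\<leftarrow>as. qpoch a q n)"

text \<open>The basic hypergeometric series with upper parameters \<open>as\<close> and lower parameters \<open>bs\<close>.
  The exponent \<open>1 + s - r\<close> may be negative, hence the integer power.\<close>

definition qhyp_term :: "complex list \<Rightarrow> complex list \<Rightarrow> complex \<Rightarrow> complex \<Rightarrow> nat \<Rightarrow> complex" where
  "qhyp_term as bs q z k =
     qpochs as q k / qpochs (q # bs) q k
     * ((-1) ^ k * q ^ (k choose 2)) powi (1 + int (length bs) - int (length as)) * z ^ k"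

definition qhyp :: "complex list \<Rightarrow> complex list \<Rightarrow> complex \<Rightarrow> complex \<Rightarrow> complex" where
  "qhyp as bs q z = (\<Sum>k. qhyp_term as bs q z k)"

text \<open>The continuous \<open>q\<close>-ultraspherical (Rogers) polynomials \<open>C\<^sub>n(x;\<beta>|q)\<close> for \<open>x \<in> [-1,1]\<close>,
  written as \<open>x = cos \<theta>\<close> with \<open>\<theta> \<in> [0,\<pi>]\<close>. If \<open>\<beta>\<close> is a positive power of \<open>q\<close>, the lower
  \<open>q\<close>-shifted factorial vanishes at some indices \<open>k > n\<close>; there the numerator \<open>(q\<^sup>-\<^sup>n;q)\<^sub>k\<close> is
  also zero, and \<open>0 / 0 = 0\<close> gives the terminating sum over \<open>k \<le> n\<close>.\<close>

definition rogers_C :: "nat \<Rightarrow> real \<Rightarrow> complex \<Rightarrow> complex \<Rightarrow> complex" where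
  "rogers_C n x \<beta> q =
     (let \<theta> = arccos x in
       qpoch \<beta> q n / qpoch q q n * cis (real n * \<theta>)
       * qhyp [q powi (- int n), \<beta>] [inverse \<beta> * q powi (1 - int n)]
           q (q * inverse \<beta> * cis (- 2 * \<theta>)))"

end

theory Submission
  imports Defs "HOL-Analysis.Infinite_Sum" "HOL-Analysis.Infinite_Products"
begin

text \<open>The identity is the composition of two facts about Rogers polynomials.

The first is a generating function: for every $\beta$ the product of the two ${}_2\phi_1$ series is
\[ \sum_N \frac{(-\beta,\beta q^{1/2};q)_N}{(\beta^2,-\beta q^{1/2};q)_N}\,C_N(x;\beta|q)\,t^N. \]
Comparing coefficients of $t^N$, this says that a Cauchy product of two explicit sequences is a multiple
of $C_N$. The Cauchy product satisfies the three-term recurrence that $C_N$ inherits from Rogers'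
recurrence; this is shown by creative telescoping with an explicit certificate
(\<open>cauchy_coeff_recurrence\<close>), and the first two values agree (\<open>pair_product_eq_rogers_form\<close>).

The second is Rogers' connection formula, which expands $C_N(x;\beta|q)$ in the polynomials
$C_{N-2k}(x;\gamma|q)$ (\<open>rogers_form_connection\<close>). Coefficientwise it is the terminating case of the
very-well-poised ${}_6\phi_5$ summation (\<open>rogers_coeff_connection\<close>), proved by telescoping as well.

Inserting the second expansion into the first and collecting the terms with $N-2k=n$ gives the right-hand
side: with $N=n+2k$ every factor $(a;q)_{n+2k}$ splits as $(a;q)_n$ times four factors
$(\pm y,\pm yq^{1/2};q)_k$ with $y^2=aq^n$, which accounts for the parameters of the ${}_{10}\phi_9$ that
come with a sign $\pm$; the remaining ones stem from the connection coefficient. The rearrangement is justified by absolute convergence (\<open>sums_rearrange_by_twos\<close>): all $q$-shifted factorials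
involved are bounded, and so are the reciprocals of those in denominators, hence the terms are dominated by
a multiple of $(n+1)|t|^n|\gamma t^2|^k$.

The Rogers polynomials are carried along as binary forms in two free variables $a,c$, with $a=e^{i\theta}$,
$c=e^{-i\theta}$ or the multiples of these by $\beta^{1/2}$. In the latter case $\beta=ac$, so that
$\beta^{1/2}$ disappears and the telescoping identities become polynomial identities in $a$, $c$, $q^{1/2}$ and powers of $q$.\<close>

section \<open>Shifted factorials\<close>

lemma qpoch_0 [simp]: "qpoch a q 0 = 1"
  by (simp add: qpoch_def)

lemma qpoch_Suc: "qpoch a q (Suc n) = qpoch a q n * (1 - a * q ^ n)"
  by (simp add: qpoch_def)

lemma qpoch_nonzero: "(\<And>j. a * q ^ j \<noteq> 1) \<Longrightarrow> qpoch a q n \<noteq> 0"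
  by (simp add: qpoch_def)

lemma param_power_neq_1:
  fixes a q :: complex
  assumes "cmod q < 1" "cmod a < 1"
  shows "a * q ^ j \<noteq> 1"
proof -
  have "cmod (a * q ^ j) \<le> cmod a * 1"
    using assms by (simp add: norm_mult norm_power power_le_one mult_left_le)
  then show ?thesis using assms by auto
qed

lemma qpoch_nz: "cmod q < 1 \<Longrightarrow> cmod a < 1 \<Longrightarrow> qpoch a q n \<noteq> 0"
  by (intro qpoch_nonzero param_power_neq_1)

lemma qpoch_add: "qpoch a q (m + n) = qpoch a q m * qpoch (a * q ^ m) q n"
  by (induction n) (simp_all add: qpoch_Suc power_add mult_ac)

text \<open>With base \<open>q = s\<^sup>2\<close> the factors \<open>1 - y\<^sup>2 * q ^ (2 * j)\<close> and \<open>1 - y\<^sup>2 * q ^ (2 * j + 1)\<close> are both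
  differences of squares; this is where the \<open>\<plusminus>\<close> pairs of square roots among the parameters come from.\<close>

lemma qpoch_square_double:
  assumes "q = s\<^sup>2"
  shows "qpoch (y\<^sup>2) q (2 * k) = qpoch y q k * qpoch (- y) q k * (qpoch (y * s) q k * qpoch (- (y * s)) q k)"
proof (induction k)
  case (Suc k)
  define X where "X = q ^ k"
  have X: "q ^ (2 * k) = X\<^sup>2" "q ^ Suc (2 * k) = s\<^sup>2 * X\<^sup>2"
    by (simp_all add: X_def assms power_mult[symmetric] mult.commute)
  have 1: "1 - y\<^sup>2 * q ^ (2 * k) = (1 - y * q ^ k) * (1 - - y * q ^ k)"
    "1 - y\<^sup>2 * q ^ Suc (2 * k) = (1 - y * s * q ^ k) * (1 - - (y * s) * q ^ k)"
    unfolding X X_def[symmetric] by (simp_all add: power2_eq_square algebra_simps)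
  have "qpoch (y\<^sup>2) q (2 * Suc k) = qpoch (y\<^sup>2) q (2 * k) * (1 - y\<^sup>2 * q ^ (2 * k)) * (1 - y\<^sup>2 * q ^ Suc (2 * k))"
    by (simp add: qpoch_Suc)
  then show ?case
    unfolding Suc.IH 1 by (simp add: qpoch_Suc mult_ac)
qed simp

lemma qpoch_add_double:
  assumes "q = s\<^sup>2" "a * q ^ n = y\<^sup>2" "w = y * s"
  shows "qpoch a q (n + 2 * k)
    = qpoch a q n * (qpoch y q k * qpoch (- y) q k * (qpoch w q k * qpoch (- w) q k))"
  unfolding qpoch_add assms(2,3) qpoch_square_double[OF assms(1)] ..

text \<open>The symbols with parameters \<open>inverse (q ^ n)\<close> and \<open>inverse \<gamma> * (q / q ^ n)\<close> contain, up to sign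
  and powers of \<open>q\<close> and \<open>\<gamma>\<close>, the last \<open>k\<close> factors of \<open>qpoch q q n\<close> and \<open>qpoch \<gamma> q n\<close> in reverse order. Written
  as a product formula, the statement has an induction step in which both sides are multiplied by
  \<open>- inverse (q ^ m)\<close>, where \<open>m = n - Suc k\<close>.\<close>

lemma qpoch_reversal:
  assumes "q \<noteq> 0" "\<gamma> \<noteq> 0" "k \<le> n"
  shows "qpoch \<gamma> q n * qpoch (inverse (q ^ n)) q k * q ^ k * qpoch q q (n - k)
    = \<gamma> ^ k * qpoch (inverse \<gamma> * (q / q ^ n)) q k * qpoch \<gamma> q (n - k) * qpoch q q n"
  using assms(3)
proof (induction k)
  case 0
  then show ?case by simp
next
  case (Suc k)
  define m where "m = n - Suc k"
  have m: "n - k = Suc m" and n: "n = k + Suc m"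
    using Suc.prems by (auto simp: m_def)
  have IH: "qpoch \<gamma> q n * qpoch (inverse (q ^ n)) q k * q ^ k * (qpoch q q m * (1 - q * q ^ m))
    = \<gamma> ^ k * qpoch (inverse \<gamma> * (q / q ^ n)) q k * (qpoch \<gamma> q m * (1 - \<gamma> * q ^ m)) * qpoch q q n"
    using Suc by (simp only: m qpoch_Suc Suc_leD)
  have 1: "(1 - inverse (q ^ n) * q ^ k) * q = - inverse (q ^ m) * (1 - q * q ^ m)"
    using assms(1) by (simp add: n power_add field_simps)
  have 2: "\<gamma> * (1 - inverse \<gamma> * (q / q ^ n) * q ^ k) = - inverse (q ^ m) * (1 - \<gamma> * q ^ m)"
    using assms(1,2) by (simp add: n power_add field_simps)
  have "qpoch \<gamma> q n * qpoch (inverse (q ^ n)) q (Suc k) * q ^ Suc k * qpoch q q m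
      = qpoch \<gamma> q n * qpoch (inverse (q ^ n)) q k * q ^ k * qpoch q q m
        * ((1 - inverse (q ^ n) * q ^ k) * q)"
    by (simp add: qpoch_Suc mult_ac)
  also have "\<dots> = - inverse (q ^ m) * (qpoch \<gamma> q n * qpoch (inverse (q ^ n)) q k * q ^ k
      * (qpoch q q m * (1 - q * q ^ m)))"
    unfolding 1 by (simp add: mult_ac)
  also have "\<dots> = \<gamma> ^ k * qpoch (inverse \<gamma> * (q / q ^ n)) q k * qpoch \<gamma> q m * qpoch q q n
      * (\<gamma> * (1 - inverse \<gamma> * (q / q ^ n) * q ^ k))"
    unfolding IH 2 by (simp add: mult_ac)
  also have "\<dots> = \<gamma> ^ Suc k * qpoch (inverse \<gamma> * (q / q ^ n)) q (Suc k) * qpoch \<gamma> q m * qpoch q q n"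
    by (simp add: qpoch_Suc mult_ac)
  finally show ?case by (simp add: m_def)
qed

section \<open>Rogers polynomials as binary forms\<close>

definition rogers_coeff :: "complex \<Rightarrow> complex \<Rightarrow> nat \<Rightarrow> complex" where
  "rogers_coeff \<beta> q k = qpoch \<beta> q k / qpoch q q k"

text \<open>The homogeneous version of the Rogers polynomial: \<open>C\<^sub>n(cos \<theta>; \<beta>|q)\<close> is the value at
  \<open>a = cis \<theta>\<close>, \<open>c = cis (- \<theta>)\<close>.\<close>

definition rogers_form :: "complex \<Rightarrow> complex \<Rightarrow> complex \<Rightarrow> complex \<Rightarrow> nat \<Rightarrow> complex" where
  "rogers_form \<beta> q a c n =
     (\<Sum>k\<le>n. rogers_coeff \<beta> q k * rogers_coeff \<beta> q (n - k) * c ^ k * a ^ (n - k))"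

lemma rogers_coeff_0 [simp]: "rogers_coeff \<beta> q 0 = 1"
  by (simp add: rogers_coeff_def)

lemma rogers_coeff_Suc:
  assumes "\<And>j. q ^ Suc j \<noteq> 1"
  shows "(1 - q ^ Suc k) * rogers_coeff \<beta> q (Suc k) = (1 - \<beta> * q ^ k) * rogers_coeff \<beta> q k"
  using assms[of k] by (simp add: rogers_coeff_def qpoch_Suc)

lemma rogers_form_scale: "rogers_form \<beta> q (s * a) (s * c) n = s ^ n * rogers_form \<beta> q a c n"
  unfolding rogers_form_def sum_distrib_left
  by (intro sum.cong) (auto simp: power_mult_distrib power_add[symmetric] mult_ac)

lemma rogers_form_commute: "rogers_form \<beta> q a c n = rogers_form \<beta> q c a n"
  unfolding rogers_form_def
  by (rule sum.reindex_bij_witness[of _ "\<lambda>k. n - k" "\<lambda>k. n - k"]) (auto simp: mult_ac)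

lemma sum_atMost_both_ends:
  fixes f :: "nat \<Rightarrow> 'a::comm_monoid_add"
  shows "sum f {..Suc (Suc n)} = f 0 + (\<Sum>k\<le>n. f (Suc k)) + f (Suc (Suc n))"
  by (simp only: sum.atMost_Suc[of f "Suc n"] sum.atMost_Suc_shift[of f n])

lemma rogers_coefficient_identity:
  fixes x0 x1 y0 y1 :: complex
  assumes nz: "1 - q * J \<noteq> 0" "1 - q * M \<noteq> 0"
    and x: "(1 - q * J) * x1 = (1 - \<beta> * J) * x0"
    and y: "(1 - q * M) * y1 = (1 - \<beta> * M) * y0"
  shows "(1 - q * q * (J * M)) * (x1 * y1) + (1 - \<beta>\<^sup>2 * (J * M)) * (x0 * y0)
    = (1 - \<beta> * q * (J * M)) * (x1 * y0 + x0 * y1)"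
proof -
  have "x1 = (1 - \<beta> * J) * x0 / (1 - q * J)" "y1 = (1 - \<beta> * M) * y0 / (1 - q * M)"
    using nz x y by (simp_all add: field_simps)
  then show ?thesis using nz
    by (simp add: divide_simps) algebra
qed

text \<open>The three-term recurrence. The coefficients of each monomial \<open>c ^ Suc k * a ^ Suc (n - k)\<close> match by
  \<open>rogers_coefficient_identity\<close>; the two pure powers need only \<open>rogers_coeff_Suc\<close>.\<close>

lemma rogers_recurrence:
  assumes nz: "\<And>j. q ^ Suc j \<noteq> 1"
  shows "(1 - q ^ Suc (Suc n)) * rogers_form \<beta> q a c (Suc (Suc n))
       + a * c * (1 - \<beta>\<^sup>2 * q ^ n) * rogers_form \<beta> q a c n
     = (a + c) * (1 - \<beta> * q ^ Suc n) * rogers_form \<beta> q a c (Suc n)"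
proof -
  let ?h = "rogers_coeff \<beta> q"
  define m where "m k = c ^ Suc k * a ^ Suc (n - k)" for k
  have H2: "rogers_form \<beta> q a c (Suc (Suc n)) = ?h (Suc (Suc n)) * a ^ Suc (Suc n)
      + (\<Sum>k\<le>n. m k * (?h (Suc k) * ?h (Suc (n - k)))) + ?h (Suc (Suc n)) * c ^ Suc (Suc n)"
    unfolding rogers_form_def sum_atMost_both_ends m_def
    by (simp add: Suc_diff_le mult_ac cong: sum.cong_simp)
  have H1a: "a * rogers_form \<beta> q a c (Suc n) = ?h (Suc n) * a ^ Suc (Suc n)
      + (\<Sum>k\<le>n. m k * (?h (Suc k) * ?h (n - k)))"
    unfolding rogers_form_def sum.atMost_Suc_shift m_def
    by (simp add: sum_distrib_left distrib_left mult_ac)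
  have H1c: "c * rogers_form \<beta> q a c (Suc n)
      = (\<Sum>k\<le>n. m k * (?h k * ?h (Suc (n - k)))) + ?h (Suc n) * c ^ Suc (Suc n)"
    unfolding rogers_form_def sum.atMost_Suc m_def
    by (simp add: sum_distrib_left distrib_left Suc_diff_le mult_ac cong: sum.cong_simp)
  have H0: "a * c * rogers_form \<beta> q a c n = (\<Sum>k\<le>n. m k * (?h k * ?h (n - k)))"
    unfolding rogers_form_def m_def by (simp add: sum_distrib_left mult_ac)
  have inner: "(1 - q ^ Suc (Suc n)) * (?h (Suc k) * ?h (Suc (n - k)))
        + (1 - \<beta>\<^sup>2 * q ^ n) * (?h k * ?h (n - k))
      = (1 - \<beta> * q ^ Suc n) * (?h (Suc k) * ?h (n - k) + ?h k * ?h (Suc (n - k)))"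
    if "k \<le> n" for k
  proof -
    have "q ^ k * q ^ (n - k) = q ^ n"
      using that by (simp add: power_add[symmetric])
    then show ?thesis
      using rogers_coefficient_identity[where q = q and \<beta> = \<beta> and J = "q ^ k" and M = "q ^ (n - k)"
          and ?x0.0 = "?h k" and ?x1.0 = "?h (Suc k)"
          and ?y0.0 = "?h (n - k)" and ?y1.0 = "?h (Suc (n - k))"]
        rogers_coeff_Suc[OF nz, of k \<beta>] rogers_coeff_Suc[OF nz, of "n - k" \<beta>]
        nz[of k] nz[of "n - k"] by (simp add: mult.assoc)
  qed
  have sums: "(1 - q ^ Suc (Suc n)) * (\<Sum>k\<le>n. m k * (?h (Suc k) * ?h (Suc (n - k))))
      + (1 - \<beta>\<^sup>2 * q ^ n) * (\<Sum>k\<le>n. m k * (?h k * ?h (n - k)))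
    = (1 - \<beta> * q ^ Suc n) * ((\<Sum>k\<le>n. m k * (?h (Suc k) * ?h (n - k)))
        + (\<Sum>k\<le>n. m k * (?h k * ?h (Suc (n - k)))))" (is "?L = ?R")
  proof -
    have "?L = (\<Sum>k\<le>n. m k * ((1 - q ^ Suc (Suc n)) * (?h (Suc k) * ?h (Suc (n - k)))
        + (1 - \<beta>\<^sup>2 * q ^ n) * (?h k * ?h (n - k))))"
      by (simp only: sum_distrib_left sum.distrib[symmetric] distrib_left mult.left_commute)
    also have "\<dots> = (\<Sum>k\<le>n. m k * ((1 - \<beta> * q ^ Suc n)
        * (?h (Suc k) * ?h (n - k) + ?h k * ?h (Suc (n - k)))))"
      using inner by (intro sum.cong) auto
    also have "\<dots> = ?R"
      by (simp only: sum_distrib_left sum.distrib[symmetric] distrib_left mult.left_commute)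
    finally show ?thesis .
  qed
  have combine: "d * H2 + a * c * e * H0 = (a + c) * f * H1"
    if "H2 = h2 * A + S11 + h2 * C" "a * H1 = h1 * A + S10" "c * H1 = S01 + h1 * C"
      "a * c * H0 = S00" "d * S11 + e * S00 = f * (S10 + S01)" "d * h2 = f * h1"
    for d e f A C H0 H1 H2 h1 h2 S00 S01 S10 S11 :: complex
    using that by algebra
  show ?thesis
    by (rule combine[OF H2 H1a H1c H0 sums rogers_coeff_Suc[OF nz, of "Suc n" \<beta>]])
qed

lemma rogers_C_eq_rogers_form:
  fixes \<gamma> q :: complex and \<theta> :: real
  assumes q: "q \<noteq> 0" "cmod q < 1" and \<gamma>: "\<gamma> \<noteq> 0" "cmod \<gamma> < 1"
  shows "rogers_C n (cos \<theta>) \<gamma> q = rogers_form \<gamma> q (cis \<theta>) (cis (- \<theta>)) n"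
proof -
  \<comment> \<open>\<open>rogers_C\<close> uses the angle \<open>arccos x\<close>, which is \<open>\<plusminus>\<theta>\<close> modulo \<open>2\<pi>\<close>; the sign is irrelevant by symmetry\<close>
  define \<phi> where "\<phi> = arccos (cos \<theta>)"
  define w v where "w = cis \<phi>" and "v = cis (- \<phi>)"
  have wv: "w * v = 1" by (simp add: w_def v_def cis_mult)
  define f where "f k = qhyp_term [q powi (- int n), \<gamma>] [inverse \<gamma> * q powi (1 - int n)]
           q (q * inverse \<gamma> * cis (- 2 * \<phi>)) k" for k
  have pw: "q powi (- int n) = inverse (q ^ n)" "q powi (1 - int n) = q / q ^ n"
    using q by (simp_all add: power_int_minus power_int_diff)
  have f: "f k = qpoch (inverse (q ^ n)) q k * qpoch \<gamma> q k
      / (qpoch q q k * qpoch (inverse \<gamma> * (q / q ^ n)) q k) * (q * inverse \<gamma> * (v * v)) ^ k" for k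
  proof -
    have "cis (- 2 * \<phi>) = v * v" by (simp add: v_def cis_mult)
    then show ?thesis unfolding f_def qhyp_term_def qpochs_def pw by simp
  qed
  have zero: "f k = 0" if "k \<notin> {..n}" for k
  proof -
    have "qpoch (inverse (q ^ n)) q k = 0"
      unfolding qpoch_def using that q by (intro prod_zero) (auto intro!: bexI[of _ n])
    then show ?thesis by (simp add: f)
  qed
  have term_eq: "qpoch \<gamma> q n / qpoch q q n * w ^ n * f k
      = rogers_coeff \<gamma> q k * rogers_coeff \<gamma> q (n - k) * v ^ k * w ^ (n - k)" if k: "k \<le> n" for k
  proof -
    have nz: "qpoch q q i \<noteq> 0" "qpoch \<gamma> q i \<noteq> 0" for i
      using qpoch_nz q \<gamma> by auto
    let ?L = "qpoch (inverse \<gamma> * (q / q ^ n)) q k"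
    have L: "?L \<noteq> 0"
    proof -
      have "inverse \<gamma> * (q / q ^ n) * q ^ j \<noteq> 1" if "j < k" for j
      proof -
        from that k obtain i where n: "n = j + Suc i"
          by (metis less_imp_Suc_add less_le_trans add_Suc_right)
        have "inverse \<gamma> * (q / q ^ n) * q ^ j = inverse (\<gamma> * q ^ i)"
          using q by (simp add: n power_add field_simps)
        then show ?thesis
          using param_power_neq_1[OF q(2) \<gamma>(2), of i] by (metis inverse_inverse_eq inverse_1)
      qed
      then show ?thesis by (auto simp: qpoch_def)
    qed
    have wn: "w ^ n * (v * v) ^ k = v ^ k * w ^ (n - k)"
    proof -
      have "w ^ n = w ^ (n - k) * w ^ k"
        using k by (simp add: power_add[symmetric])
      then have "w ^ n * (v * v) ^ k = v ^ k * w ^ (n - k) * (w * v) ^ k"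
        by (simp add: power_mult_distrib mult_ac)
      then show ?thesis by (simp add: wv)
    qed
    have "qpoch \<gamma> q n / qpoch q q n * w ^ n * f k
      = (qpoch \<gamma> q n * qpoch (inverse (q ^ n)) q k * q ^ k * qpoch q q (n - k))
        * qpoch \<gamma> q k * (w ^ n * (v * v) ^ k) / (qpoch q q n * qpoch q q k * ?L * \<gamma> ^ k * qpoch q q (n - k))"
      unfolding f power_mult_distrib using nz by (simp add: divide_simps power_mult_distrib)
    also have "\<dots> = rogers_coeff \<gamma> q k * rogers_coeff \<gamma> q (n - k) * v ^ k * w ^ (n - k)"
      unfolding qpoch_reversal[OF q(1) \<gamma>(1) k] wn rogers_coeff_def
      using nz L \<gamma> by (simp add: divide_simps)
    finally show ?thesis .
  qed
  have "qhyp [q powi (- int n), \<gamma>] [inverse \<gamma> * q powi (1 - int n)] q (q * inverse \<gamma> * cis (- 2 * \<phi>))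
      = (\<Sum>k\<le>n. f k)"
    unfolding qhyp_def f_def[symmetric] by (rule suminf_finite) (use zero in auto)
  then have "rogers_C n (cos \<theta>) \<gamma> q = qpoch \<gamma> q n / qpoch q q n * w ^ n * (\<Sum>k\<le>n. f k)"
    by (simp add: rogers_C_def Let_def \<phi>_def[symmetric] w_def Complex.DeMoivre)
  also have "\<dots> = rogers_form \<gamma> q w v n"
    unfolding rogers_form_def sum_distrib_left by (intro sum.cong refl term_eq) simp
  also have "\<dots> = rogers_form \<gamma> q (cis \<theta>) (cis (- \<theta>)) n"
  proof -
    have "cos \<phi> = cos \<theta>" by (simp add: \<phi>_def)
    moreover from this have "sin \<phi> = sin \<theta> \<or> sin \<phi> = - sin \<theta>"
      by (metis sin_squared_eq power2_eq_iff)
    ultimately have "(w = cis \<theta> \<and> v = cis (- \<theta>)) \<or> (w = cis (- \<theta>) \<and> v = cis \<theta>)"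
      by (auto simp: w_def v_def complex_eq_iff)
    then show ?thesis using rogers_form_commute by auto
  qed
  finally show ?thesis .
qed

section \<open>The product of the two series\<close>

definition cauchy_coeff :: "(nat \<Rightarrow> complex) \<Rightarrow> (nat \<Rightarrow> complex) \<Rightarrow> nat \<Rightarrow> complex" where
  "cauchy_coeff u v n = (\<Sum>k\<le>n. u k * v (n - k))"

text \<open>The numerator of the telescoping certificate for index \<open>n\<close>, with \<open>K = q ^ k\<close>, \<open>M = q ^ (n - k)\<close> and
  \<open>q = p\<^sup>2\<close>. As a function of \<open>k\<close> it is a linear combination of \<open>1 / K\<close>, \<open>1 / K\<^sup>2\<close>, \<open>1 / K\<^sup>3\<close>; an ansatz of
  this form gives an overdetermined linear system for the three coefficients, whose unique solution is used
  here. The coefficients are divisible by \<open>q ^ n\<close>, \<open>(q ^ n)\<^sup>2\<close>, \<open>(q ^ n) ^ 4\<close> respectively, so that replacing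
  \<open>q ^ n\<close> by \<open>K * M\<close> removes the negative powers.\<close>

definition cert_poly :: "complex \<Rightarrow> complex \<Rightarrow> complex \<Rightarrow> complex \<Rightarrow> complex \<Rightarrow> complex" where
  "cert_poly a c p K M =
     a * M * (- (p^2) - c + p*c + p*a*c + a*c*(K*M) * (- p + p*c - p^2*c + a*c))
   + a * M^2 * ((p*c^2 - p^3*a*c)
       + (K*M) * (a*c^2 * (- p + p^2 - p^3 + p^4) + a*c^3 * (1 - p^2)
                  + a^2*c^2 * (- (p^2) + p^4) + a^2*c^3 * (1 - p + p^2 - p^3))
       + (K*M)^2 * (- p*a^2*c^4 + p^3*a^3*c^3))
   + p^2 * (K*M) * M^3 * a^2*c^3 * (p^2 - a + p*a - p*a*c + a*c*(K*M) * (p + p*a - p^2*a - a*c))"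

text \<open>The telescoping relation after the common factor \<open>u k * v (N - k)\<close> is cancelled and denominators are
  cleared, where \<open>K = q ^ k\<close>, \<open>W = q ^ (N - k)\<close> and the index \<open>n\<close> of \<open>cert_poly\<close> is \<open>N + 1\<close>. Here \<open>N\<close> and \<open>Q\<close> are the powers \<open>q ^ N\<close> and \<open>q ^ (N + 1)\<close>, and \<open>L\<close> stands for \<open>K / p\<close>, which keeps
  the identity polynomial.\<close>

lemma cert_poly_identity:
  fixes a c p L K W :: complex
  assumes "K = p*L" "N = K*W" "Q = p^2*N" "M = p^2*W" "q = p^2"
  shows "a*c*(1+a*c*N)*(1-a*c*p*N)*(1+a*c*Q)*(1-a*c*p*Q) * (((1-M)*(1+a*c*p*W)) * ((1-q*M)*(1+a*c*p*M)))
      - (a+c)*(1-a*c*Q)*(1+a*c*Q)*(1-a*c*p*Q)*(1+a*c*p*N) * ((a*(1-c*p*W)*(1+c*W)) * ((1-q*M)*(1+a*c*p*M)))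
      + (1-q*Q)*(1-(a*c)^2*Q)*(1+a*c*p*Q)*(1+a*c*p*N) * ((a*(1-c*p*W)*(1+c*W)) * (a*(1-p*c*M)*(1+c*M)))
    = cert_poly a c p (q*K) W * ((c*(1-a*K)*(1+p*a*K)) * ((1-q*M)*(1+a*c*p*M)))
      - cert_poly a c p K M * (((1-K)*(1+a*c*L)) * (a*(1-c*p*W)*(1+c*W)))"
  unfolding assms cert_poly_def by algebra

text \<open>The relation that remains at the upper end \<open>k = N + 1\<close>, where the general one would involve the
  nonexistent value \<open>v (- 1)\<close>.\<close>

lemma cert_poly_boundary:
  fixes a c p N :: complex
  assumes "Q = p^2*N" "q = p^2"
  shows "(1-q*Q)*(1-(a*c)^2*Q)*(1+a*c*p*Q)*(1+a*c*p*N) * (a*(1-p*c)*(1+c))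
      + (1-(a*c)^2*Q)*(1+a*c*p*N) * (c*(1-a*Q)*(1+p*a*Q)) * ((1-q)*(1+a*c*p))
      - (a+c)*(1-a*c*Q)*(1+a*c*Q)*(1-a*c*p*Q)*(1+a*c*p*N) * ((1-q)*(1+a*c*p))
      + cert_poly a c p Q 1 * ((1-Q)*(1+a*c*p*N)) = 0"
  unfolding assms cert_poly_def power_one mult_1_right by algebra

lemma telescoping_step:
  fixes u v0 v1 v2 :: complex
  assumes "D1 \<noteq> 0" "D2 \<noteq> 0"
    and v1: "D1 * v1 = X * v0" and v2: "D2 * v2 = Y * v1"
    and id: "am * (D1 * D2) - a0 * (X * D2) + ap * (X * Y) = Z1 * (U * D2) - Z0 * (E * X)"
  shows "am * (u * v0) - a0 * (u * v1) + ap * (u * v2) = Z1 * (U * u) * v0 / D1 - Z0 * (E * u) * v1 / D2"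
proof -
  have e: "v1 = X * v0 / D1" "v2 = Y * (X * v0) / (D1 * D2)"
    using assms(1-4) by (simp_all add: field_simps)
  have "am * (u * v0) - a0 * (u * v1) + ap * (u * v2)
      = (am * (D1 * D2) - a0 * (X * D2) + ap * (X * Y)) * (u * v0) / (D1 * D2)"
    unfolding e using assms(1,2) by (simp add: field_simps)
  also have "\<dots> = Z1 * (U * u) * v0 / D1 - Z0 * (E * u) * v1 / D2"
    unfolding id e using assms(1,2) by (simp add: field_simps)
  finally show ?thesis .
qed

text \<open>Creative telescoping: \<open>am * u k * v (N - k) - a0 * u k * v (N + 1 - k) + ap * u k * v (N + 2 - k)\<close> is a
  forward difference in \<open>k\<close>, for coefficients \<open>am\<close>, \<open>a0\<close>, \<open>ap\<close> independent of \<open>k\<close>. The coefficients are those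
  of the recurrence in \<open>rogers_recurrence\<close> after rescaling by the quotient of shifted factorials in
  \<open>pair_product_eq_rogers_form\<close>.\<close>

lemma cauchy_coeff_recurrence:
  fixes a c p q :: complex and u v :: "nat \<Rightarrow> complex"
  assumes q: "q = p\<^sup>2" and p: "p \<noteq> 0"
    and nq: "\<And>j. q ^ Suc j \<noteq> 1" and ne: "\<And>j. 1 + a * c * p * q ^ j \<noteq> 0"
    and v0: "v 0 = 1"
    and u: "\<And>k. (1 - q ^ Suc k) * (1 + a*c*p * q ^ k) * u (Suc k)
                = c * (1 - a * q ^ k) * (1 + p*a * q ^ k) * u k"
    and v: "\<And>k. (1 - q ^ Suc k) * (1 + a*c*p * q ^ k) * v (Suc k)
                = a * (1 - p*c * q ^ k) * (1 + c * q ^ k) * v k"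
  defines "P \<equiv> cauchy_coeff u v"
  shows "(1 - q * q ^ Suc N) * (1 - (a*c)\<^sup>2 * q ^ Suc N) * (1 + a*c*p * q ^ Suc N) * (1 + a*c*p * q ^ N)
            * P (Suc (Suc N))
       + a*c * (1 + a*c * q ^ N) * (1 - a*c*p * q ^ N) * (1 + a*c * q ^ Suc N) * (1 - a*c*p * q ^ Suc N)
            * P N
       = (a + c) * (1 - a*c * q ^ Suc N) * (1 + a*c * q ^ Suc N) * (1 - a*c*p * q ^ Suc N) * (1 + a*c*p * q ^ N)
            * P (Suc N)" (is "?ap * _ + ?am * _ = ?a0 * _")
proof -
  define D where "D m = (1 - q * q ^ m) * (1 + a*c*p * q ^ m)" for m
  have D: "D m \<noteq> 0" for m
    using nq[of m] ne[of m] by (simp add: D_def)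
  \<comment> \<open>The factor \<open>1 - q ^ k\<close> makes \<open>G 0 = 0\<close>; together with its companion it turns \<open>u (Suc k)\<close> into a
    multiple of \<open>u k\<close> without division.\<close>
  define G where "G k = cert_poly a c p (q ^ k) (q ^ (Suc N - k))
      * (((1 - q ^ k) * (1 + a*c * (q ^ k / p))) * u k) * v (Suc N - k) / D (Suc N - k)" for k
  have step: "?am * (u k * v (N - k)) - ?a0 * (u k * v (Suc N - k)) + ?ap * (u k * v (Suc (Suc N) - k))
      = G (Suc k) - G k" if "k \<le> N" for k
  proof -
    from that obtain m where N: "N = k + m"
      using le_Suc_ex by blast
    have tele: "?am * (u k * v m) - ?a0 * (u k * v (Suc m)) + ?ap * (u k * v (Suc (Suc m)))
      = cert_poly a c p (q * q ^ k) (q ^ m) * ((c * (1 - a * q ^ k) * (1 + p*a * q ^ k)) * u k) * v m / D m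
        - cert_poly a c p (q ^ k) (q ^ Suc m) * (((1 - q ^ k) * (1 + a*c * (q ^ k / p))) * u k)
            * v (Suc m) / D (Suc m)"
    proof (rule telescoping_step[OF D D])
      show "D m * v (Suc m) = a * (1 - c*p * q ^ m) * (1 + c * q ^ m) * v m"
        using v[of m] by (simp add: D_def mult_ac)
      show "D (Suc m) * v (Suc (Suc m)) = a * (1 - p*c * q ^ Suc m) * (1 + c * q ^ Suc m) * v (Suc m)"
        using v[of "Suc m"] by (simp add: D_def mult_ac)
      have e: "q ^ k = p * (q ^ k / p)" "q ^ N = q ^ k * q ^ m" "q ^ Suc N = p\<^sup>2 * q ^ N"
        "q ^ Suc m = p\<^sup>2 * q ^ m"
        using p q N by (simp_all add: power_add)
      have D1: "D m = (1 - q ^ Suc m) * (1 + a*c*p * q ^ m)"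
        by (simp add: D_def)
      show "?am * (D m * D (Suc m)) - ?a0 * (a * (1 - c*p * q ^ m) * (1 + c * q ^ m) * D (Suc m))
          + ?ap * (a * (1 - c*p * q ^ m) * (1 + c * q ^ m) * (a * (1 - p*c * q ^ Suc m) * (1 + c * q ^ Suc m)))
        = cert_poly a c p (q * q ^ k) (q ^ m) * (c * (1 - a * q ^ k) * (1 + p*a * q ^ k) * D (Suc m))
        - cert_poly a c p (q ^ k) (q ^ Suc m)
            * ((1 - q ^ k) * (1 + a*c * (q ^ k / p)) * (a * (1 - c*p * q ^ m) * (1 + c * q ^ m)))"
        unfolding D1 D_def[of "Suc m"]
        by (rule cert_poly_identity[OF e q])
    qed
    have e: "((1 - q ^ Suc k) * (1 + a*c * (q ^ Suc k / p))) * u (Suc k)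
        = (c * (1 - a * q ^ k) * (1 + p*a * q ^ k)) * u k"
    proof -
      have "q ^ Suc k / p = p * q ^ k"
        using p by (simp add: q power2_eq_square)
      then show ?thesis using u[of k] by (simp add: mult_ac)
    qed
    have "G (Suc k) = cert_poly a c p (q * q ^ k) (q ^ m)
        * ((c * (1 - a * q ^ k) * (1 + p*a * q ^ k)) * u k) * v m / D m"
      unfolding G_def e using N by simp
    moreover have "G k = cert_poly a c p (q ^ k) (q ^ Suc m)
        * (((1 - q ^ k) * (1 + a*c * (q ^ k / p))) * u k) * v (Suc m) / D (Suc m)"
      unfolding G_def using N by simp
    moreover have "N - k = m" "Suc N - k = Suc m" "Suc (Suc N) - k = Suc (Suc m)"
      using N by auto
    ultimately show ?thesis using tele by simp
  qed
  have "(\<Sum>k\<le>N. G (Suc k) - G k) = G (Suc N) - G 0"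
    by (simp add: lessThan_Suc_atMost[symmetric] sum_lessThan_telescope)
  also have "G 0 = 0"
    by (simp add: G_def)
  finally have inner: "?am * (\<Sum>k\<le>N. u k * v (N - k)) - ?a0 * (\<Sum>k\<le>N. u k * v (Suc N - k))
      + ?ap * (\<Sum>k\<le>N. u k * v (Suc (Suc N) - k)) = G (Suc N)"
    unfolding sum_distrib_left sum_subtractf[symmetric] sum.distrib[symmetric]
    using step by (simp cong: sum.cong_simp)
  have P: "P N = (\<Sum>k\<le>N. u k * v (N - k))"
    "P (Suc N) = (\<Sum>k\<le>N. u k * v (Suc N - k)) + u (Suc N)"
    "P (Suc (Suc N)) = (\<Sum>k\<le>N. u k * v (Suc (Suc N) - k)) + u (Suc N) * v 1 + u (Suc (Suc N))"
    using v0 by (simp_all add: P_def cauchy_coeff_def)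
  have boundary: "?ap * (u (Suc N) * v 1 + u (Suc (Suc N))) - ?a0 * u (Suc N) + G (Suc N) = 0"
  proof -
    define Q where "Q = q ^ Suc N"
    have QN: "Q = p\<^sup>2 * q ^ N" "Q / p = p * q ^ N"
      using p by (simp_all add: Q_def q power2_eq_square)
    have d: "D 0 = (1 - q) * (1 + a*c*p)"
      by (simp add: D_def)
    have v1: "D 0 * v 1 = a * (1 - p*c) * (1 + c)"
      using v[of 0] v0 by (simp add: D_def)
    have u2: "(1 - q * Q) * (1 + a*c*p * Q) * u (Suc (Suc N)) = (c * (1 - a * Q) * (1 + p*a * Q)) * u (Suc N)"
      using u[of "Suc N"] by (simp add: Q_def)
    have G: "D 0 * G (Suc N) = cert_poly a c p Q 1 * ((1 - Q) * (1 + a*c*p * q ^ N)) * u (Suc N)"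
      using D[of 0] v0 QN(2) by (simp add: G_def Q_def[symmetric] del: power_Suc)
    have combine: "d * (x * s * y * t * (w * v1 + w2) - a0 * w + g) = 0"
      if "d * v1 = X" "x * y * w2 = U * w" "d * g = Z * w"
        "x * s * y * t * X + s * t * U * d - a0 * d + Z = 0"
      for d x s y t w v1 w2 a0 g X U Z :: complex
    proof -
      have "d * (x * s * y * t * (w * v1 + w2) - a0 * w + g)
          = x * s * y * t * w * (d * v1) + d * s * t * (x * y * w2) - a0 * d * w + d * g"
        by (simp add: algebra_simps)
      also have "\<dots> = w * (x * s * y * t * X + s * t * U * d - a0 * d + Z)"
        unfolding that(1-3) by (simp add: algebra_simps)
      finally show ?thesis using that(4) by simp
    qed
    have "D 0 * (?ap * (u (Suc N) * v 1 + u (Suc (Suc N))) - ?a0 * u (Suc N) + G (Suc N)) = 0"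
      unfolding Q_def[symmetric]
      by (rule combine[OF v1 u2 G cert_poly_boundary[OF QN(1) q, of a c, folded d]])
    then show ?thesis using D[of 0] by simp
  qed
  have combine: "ap * (S2 + x1 + x2) + am * S0 = a0 * (S1 + y)"
    if "am * S0 - a0 * S1 + ap * S2 = g" "ap * (x1 + x2) - a0 * y + g = 0"
    for am a0 ap S0 S1 S2 x1 x2 y g :: complex
  proof -
    have "ap * (S2 + x1 + x2) + am * S0 - a0 * (S1 + y)
        = (am * S0 - a0 * S1 + ap * S2) + (ap * (x1 + x2) - a0 * y)"
      by (simp add: algebra_simps)
    also have "\<dots> = 0"
      using that by (simp add: add.commute)
    finally show ?thesis by simp
  qed
  show ?thesis
    unfolding P by (rule combine[OF inner boundary])
qed

definition pair_coeff :: "complex \<Rightarrow> complex \<Rightarrow> complex \<Rightarrow> complex \<Rightarrow> nat \<Rightarrow> complex" where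
  "pair_coeff x y e q k = qpoch x q k * qpoch y q k / (qpoch q q k * qpoch e q k)"

lemma pair_coeff_Suc:
  assumes "q ^ Suc k \<noteq> 1" "1 - e * q ^ k \<noteq> 0"
  shows "(1 - q ^ Suc k) * (1 - e * q ^ k) * pair_coeff x y e q (Suc k)
    = (1 - x * q ^ k) * (1 - y * q ^ k) * pair_coeff x y e q k"
  using assms by (simp add: pair_coeff_def qpoch_Suc)

text \<open>The coefficient of \<open>t\<^sup>n\<close> in the generating function. The recurrences of the Cauchy product and of
  the Rogers polynomials become the same after multiplication by the shifted factorials, and the identity
  holds for \<open>n = 0\<close> and \<open>n = 1\<close>.\<close>

proposition pair_product_eq_rogers_form:
  fixes a c p q :: complex
  assumes q: "q = p\<^sup>2" and p: "p \<noteq> 0"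
    and nq: "\<And>j. q ^ Suc j \<noteq> 1" and ne: "\<And>j. 1 + a * c * p * q ^ j \<noteq> 0"
  defines "P \<equiv> cauchy_coeff (\<lambda>k. pair_coeff a (- (p * a)) (- (a*c*p)) q k * c ^ k)
                          (\<lambda>k. pair_coeff (p * c) (- c) (- (a*c*p)) q k * a ^ k)"
  shows "qpoch ((a*c)\<^sup>2) q n * qpoch (- (a*c*p)) q n * P n
    = qpoch (- (a*c)) q n * qpoch (a*c*p) q n * rogers_form (a*c) q a c n"
proof -
  let ?u = "\<lambda>k. pair_coeff a (- (p * a)) (- (a*c*p)) q k * c ^ k"
  let ?v = "\<lambda>k. pair_coeff (p * c) (- c) (- (a*c*p)) q k * a ^ k"
  define \<beta> where "\<beta> = a * c"
  define X where "X n = qpoch (\<beta>\<^sup>2) q n * qpoch (- (\<beta>*p)) q n" for n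
  define Y where "Y n = qpoch (- \<beta>) q n * qpoch (\<beta>*p) q n" for n
  define H where "H n = rogers_form \<beta> q a c n" for n
  have u: "(1 - q ^ Suc k) * (1 + a*c*p * q ^ k) * ?u (Suc k)
      = c * (1 - a * q ^ k) * (1 + p*a * q ^ k) * ?u k" for k
    using pair_coeff_Suc[OF nq[of k], of "- (a*c*p)" a "- (p*a)"] ne[of k]
    by (simp add: mult.assoc)
  have v: "(1 - q ^ Suc k) * (1 + a*c*p * q ^ k) * ?v (Suc k)
      = a * (1 - p*c * q ^ k) * (1 + c * q ^ k) * ?v k" for k
    using pair_coeff_Suc[OF nq[of k], of "- (a*c*p)" "p*c" "- c"] ne[of k]
    by (simp add: mult.assoc)
  have u0: "?u 0 = 1" and v0: "?v 0 = 1" by (simp_all add: pair_coeff_def)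
  note P_rec = cauchy_coeff_recurrence[of q p a c ?v ?u, OF q p nq ne v0 u v, folded P_def \<beta>_def]
  note H_rec = rogers_recurrence[OF nq, of _ \<beta> a c, folded H_def \<beta>_def]
  have X_Suc: "X (Suc n) = X n * ((1 - \<beta>\<^sup>2 * q ^ n) * (1 + \<beta>*p * q ^ n))" for n
    by (simp add: X_def qpoch_Suc)
  have Y_Suc: "Y (Suc n) = Y n * ((1 + \<beta> * q ^ n) * (1 - \<beta>*p * q ^ n))" for n
    by (simp add: Y_def qpoch_Suc)
  have "X n * P n = Y n * H n \<and> X (Suc n) * P (Suc n) = Y (Suc n) * H (Suc n)"
  proof (induction n)
    case 0
    have "X 0 * P 0 = Y 0 * H 0"
      by (simp add: X_def Y_def P_def H_def cauchy_coeff_def rogers_form_def pair_coeff_def)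
    moreover have "X 1 * P 1 = Y 1 * H 1"
    proof -
      define d where "d = (1 - q) * (1 + a*c*p)"
      have d: "d \<noteq> 0"
        using nq[of 0] ne[of 0] by (simp add: d_def)
      have "P 1 = ?u 1 + ?v 1"
        by (simp add: P_def cauchy_coeff_def pair_coeff_def)
      moreover have "d * ?u 1 = c * (1 - a) * (1 + p*a)"
        using u[of 0] u0 by (simp add: d_def)
      moreover have "d * ?v 1 = a * (1 - p*c) * (1 + c)"
        using v[of 0] v0 by (simp add: d_def)
      ultimately have "d * P 1 = c * (1 - a) * (1 + p*a) + a * (1 - p*c) * (1 + c)"
        by (simp only: distrib_left[of d])
      also have "\<dots> = (a + c) * (1 - a*c*p)"
        by algebra
      finally have P1: "d * P 1 = (a + c) * (1 - a*c*p)" .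
      have H1: "(1 - q) * H 1 = (1 - \<beta>) * (a + c)"
        using rogers_coeff_Suc[OF nq, of 0 \<beta>]
        by (simp add: H_def rogers_form_def) algebra
      have "d * (X 1 * P 1)
          = (1 - \<beta>\<^sup>2) * (1 + \<beta>*p) * ((a + c) * (1 - a*c*p))"
        unfolding P1[symmetric] by (simp add: X_def qpoch_def)
      also have "\<dots> = (1 + a*c*p) * ((1 + \<beta>) * (1 - \<beta>*p)) * ((1 - \<beta>) * (a + c))"
        unfolding \<beta>_def by algebra
      also have "\<dots> = d * (Y 1 * H 1)"
        unfolding H1[symmetric] by (simp add: Y_def qpoch_def d_def)
      finally show ?thesis using d by simp
    qed
    ultimately show ?case by simp
  next
    case (Suc n)
    \<comment> \<open>the common factor \<open>x * s2\<close> is nonzero and is cancelled at the end\<close>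
    have combine: "x * s2 * X1 * P2 = x * s2 * Y2 * H2" 
      if "x * s1 * y1 * s2 * P2 + \<beta> * e * f * e1 * f1 * P0 = (a + c) * g * e1 * f1 * s2 * P1"
        "x * H2 + \<beta> * r * H0 = (a + c) * g * H1" "X0 * P0 = Y0 * H0" "X1' * P1 = Y1 * H1"
        "X1' = X0 * (r * s2)" "X1 = X1' * (s1 * y1)" "Y1 = Y0 * (e * f)" "Y2 = Y1 * (e1 * f1)"
      for x s1 y1 s2 P0 P1 P2 e f e1 f1 g H0 H1 H2 X0 X1 X1' Y0 Y1 Y2 r :: complex
    proof -
      have "x * s2 * X1 * P2 = X1' * (x * s1 * y1 * s2 * P2)"
        using that(6) by simp
      also have "\<dots> = (a + c) * g * e1 * f1 * s2 * (X1' * P1) - \<beta> * e * f * e1 * f1 * r * s2 * (X0 * P0)"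
        using that(1,5) by algebra
      also have "\<dots> = s2 * Y2 * ((a + c) * g * H1 - \<beta> * r * H0)"
        unfolding that(3,4,7,8) by algebra
      finally show ?thesis using that(2) by algebra
    qed
    have nz: "(1 - q * q ^ Suc n) * (1 + \<beta>*p * q ^ n) \<noteq> 0"
      using nq[of "Suc n"] ne[of n] by (simp add: \<beta>_def)
    have "(1 - q * q ^ Suc n) * (1 + \<beta>*p * q ^ n) * X (Suc (Suc n)) * P (Suc (Suc n))
      = (1 - q * q ^ Suc n) * (1 + \<beta>*p * q ^ n) * Y (Suc (Suc n)) * H (Suc (Suc n))"
      by (rule combine[OF P_rec[of n] H_rec[of n, unfolded power_Suc[of q "Suc n"]]
            conjunct1[OF Suc.IH] conjunct2[OF Suc.IH] X_Suc X_Suc Y_Suc Y_Suc])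
    then show ?case using nz Suc.IH by (simp del: power_Suc add: mult.assoc)
  qed
  then show ?thesis
    by (simp add: X_def Y_def H_def \<beta>_def)
qed

section \<open>The connection formula\<close>

definition connection_coeff :: "complex \<Rightarrow> complex \<Rightarrow> complex \<Rightarrow> nat \<Rightarrow> nat \<Rightarrow> complex" where
  "connection_coeff \<beta> \<gamma> q n k =
     qpoch (\<beta> / \<gamma>) q k * \<gamma> ^ k * qpoch \<beta> q (n - k) * (1 - \<gamma> * q ^ (n - 2 * k))
       / (qpoch q q k * qpoch \<gamma> q (Suc (n - k)))"

text \<open>The certificate of \<open>rogers_coeff_connection\<close>, with \<open>K = q ^ k\<close>, \<open>A = q ^ j / q ^ k\<close>, \<open>B = q ^ m / q ^ k\<close>. The factor
  \<open>1 - q * A\<close> allows \<open>c1\<close> to be eliminated by \<open>rec\<close>; what is left is a polynomial identity.\<close>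

lemma wz_step:
  fixes A B K q \<beta> \<gamma> c0 c1 y \<phi> :: complex
  assumes rec: "(1 - q * A) * c1 = (1 - \<gamma> * A) * c0"
  shows "(1 - q * A) * ((1 - q * (A * K)) * (\<phi> * ((1 - \<beta> * (A * B * K)) * (1 - \<gamma> * q * A * B)) * (c1 * y))
      - (1 - \<beta> * (A * K)) * (\<phi> * ((1 - \<gamma> * q * (A * B * K)) * (1 - \<gamma> * A * B)) * (c0 * y))
      - (- A * (\<phi> * (1 - \<gamma> * q * (A * B * K))) * (\<gamma> - \<beta> * K) * (1 - B) * (c0 * y)
         - - q * A * (1 - K) * (1 - \<gamma> * B) * (\<phi> * (1 - \<beta> * (A * B * K))) * (c1 * y))) = 0"
    (is "?lhs = 0")
proof -
  let ?E1 = "(1-q*A*K)*(1-\<beta>*A*B*K)*(1-\<gamma>*q*A*B) - q*A*(1-K)*(1-\<beta>*A*B*K)*(1-\<gamma>*B)"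
  let ?E0 = "(1-\<beta>*A*K)*(1-\<gamma>*q*A*B*K)*(1-\<gamma>*A*B) - A*(\<gamma>-\<beta>*K)*(1-\<gamma>*q*A*B*K)*(1-B)"
  have "?lhs = \<phi> * y * (?E1 * ((1 - q * A) * c1) - ?E0 * (1 - q * A) * c0)"
    by algebra
  also have "\<dots> = \<phi> * y * c0 * (?E1 * (1 - \<gamma> * A) - ?E0 * (1 - q * A))"
    unfolding rec by algebra
  also have "?E1 * (1 - \<gamma> * A) - ?E0 * (1 - q * A) = 0"
    by algebra
  finally show ?thesis by simp
qed

text \<open>The terminating \<open>\<^sub>6\<phi>\<^sub>5\<close> summation. Both sides satisfy the same first-order recurrence in \<open>j\<close>: for
  the sum, with terms \<open>T j m k\<close>, this holds since
  \<open>(1 - q ^ Suc j) * T (Suc j) m k - (1 - \<beta> * q ^ j) * T j m k\<close> is a forward difference in \<open>k\<close>.\<close>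

lemma rogers_coeff_connection:
  fixes \<beta> \<gamma> q :: complex
  assumes q: "q \<noteq> 0" and nq: "\<And>j. q ^ Suc j \<noteq> 1"
    and g: "\<gamma> \<noteq> 0" and ng: "\<And>j. \<gamma> * q ^ j \<noteq> 1"
  shows "rogers_coeff \<beta> q j * rogers_coeff \<beta> q m
    = (\<Sum>k\<le>min j m. connection_coeff \<beta> \<gamma> q (j + m) k
        * (rogers_coeff \<gamma> q (j - k) * rogers_coeff \<gamma> q (m - k)))"
proof -
  \<comment> \<open>Extending the coefficients by zero lets \<open>k\<close> run up to \<open>m\<close> for every \<open>j\<close>; the recurrences
    \<open>c_Suc\<close> and \<open>c_Suc'\<close> survive because they contain the factor that vanishes at the border.\<close>
  define c where "c j k = (if k \<le> j then rogers_coeff \<gamma> q (j - k) else 0)" for j k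
  define w where "w k = qpoch (\<beta> / \<gamma>) q k * \<gamma> ^ k / qpoch q q k" for k
  define T where "T j m k = w k * qpoch \<beta> q (j + m - k) * (1 - \<gamma> * (q ^ j / q ^ k) * (q ^ m / q ^ k))
      / qpoch \<gamma> q (Suc (j + m - k)) * (c j k * c m k)" for j m k
  define S where "S j m = (\<Sum>k\<le>m. T j m k)" for j m
  have w_Suc: "(1 - q ^ Suc k) * w (Suc k) = (\<gamma> - \<beta> * q ^ k) * w k" for k
  proof -
    have "\<gamma> * (1 - \<beta> / \<gamma> * q ^ k) = \<gamma> - \<beta> * q ^ k"
      using g by (simp add: field_simps)
    moreover have "(1 - q ^ Suc k) * w (Suc k) = (\<gamma> * (1 - \<beta> / \<gamma> * q ^ k)) * w k"
      using nq[of k] by (simp add: w_def qpoch_Suc)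
    ultimately show ?thesis by simp
  qed
  have c_Suc: "(1 - q * (q ^ j / q ^ k)) * c (Suc j) k = (1 - \<gamma> * (q ^ j / q ^ k)) * c j k" for j k
  proof (cases "k \<le> j")
    case True
    then show ?thesis
      using rogers_coeff_Suc[OF nq, of "j - k" \<gamma>] q by (simp add: c_def Suc_diff_le power_diff)
  next
    case False
    then show ?thesis using q by (cases "k = Suc j") (auto simp: c_def)
  qed
  have c_Suc': "(1 - \<gamma> * (q ^ m / q ^ Suc k)) * c m (Suc k) = (1 - q ^ m / q ^ k) * c m k" for m k
  proof (cases "Suc k \<le> m")
    case True
    then show ?thesis
      using rogers_coeff_Suc[OF nq, of "m - Suc k" \<gamma>] q
      by (simp add: c_def Suc_diff_Suc power_diff)
  next
    case False
    then show ?thesis using q by (cases "k = m") (auto simp: c_def)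
  qed
  have step: "(1 - q ^ Suc j) * S (Suc j) m = (1 - \<beta> * q ^ j) * S j m" for j
  proof -
    \<comment> \<open>\<open>G\<close> vanishes at both ends: at \<open>0\<close> by the factor \<open>1 - q ^ k\<close>, at \<open>Suc m\<close> by \<open>c m\<close>\<close>
    define G where "G k = - q * (q ^ j / q ^ k) * (1 - q ^ k) * (1 - \<gamma> * (q ^ m / q ^ k))
        * w k * qpoch \<beta> q (Suc (j + m) - k) / qpoch \<gamma> q (Suc (Suc (j + m) - k)) * (c (Suc j) k * c m k)" for k
    have "(1 - q ^ Suc j) * T (Suc j) m k - (1 - \<beta> * q ^ j) * T j m k = G (Suc k) - G k"
      if "k \<le> m" for k
    proof -
      define i where "i = j + m - k"
      have i: "j + m - k = i" "Suc j + m - k = Suc i" "Suc (j + m) - k = Suc i" "Suc (j + m) - Suc k = i"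
        using that by (auto simp: i_def)
      define K A B where "K = q ^ k" and "A = q ^ j / q ^ k" and "B = q ^ m / q ^ k"
      have K0: "K \<noteq> 0" using q by (simp add: K_def)
      have e: "q ^ j = A * K" "q ^ m = B * K" "q ^ i = A * B * K"
        using q that by (simp_all add: A_def B_def K_def i_def power_diff power_add)
      \<comment> \<open>the common part of the four terms, with the longest denominator\<close>
      define \<phi> where "\<phi> = w k * qpoch \<beta> q i / qpoch \<gamma> q (Suc (Suc i))"
      have gi: "1 - \<gamma> * q ^ Suc i \<noteq> 0" "qpoch \<gamma> q (Suc i) \<noteq> 0"
        using ng[of "Suc i"] ng qpoch_nonzero by auto
      have \<phi>: "w k * qpoch \<beta> q i / qpoch \<gamma> q (Suc i) = \<phi> * (1 - \<gamma> * q * (A * B * K))"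
        unfolding \<phi>_def qpoch_Suc[of \<gamma> q "Suc i"] using gi e(3) by (simp add: mult.assoc)
      have T0: "T j m k = \<phi> * ((1 - \<gamma> * q * (A * B * K)) * (1 - \<gamma> * A * B)) * (c j k * c m k)"
      proof -
        have "T j m k = (w k * qpoch \<beta> q i / qpoch \<gamma> q (Suc i)) * (1 - \<gamma> * A * B) * (c j k * c m k)"
          unfolding T_def i A_def[symmetric] B_def[symmetric] by simp
        then show ?thesis unfolding \<phi> by (simp add: mult_ac)
      qed
      have T1: "T (Suc j) m k = \<phi> * ((1 - \<beta> * (A * B * K)) * (1 - \<gamma> * q * A * B)) * (c (Suc j) k * c m k)"
        unfolding T_def i A_def[symmetric] B_def[symmetric] \<phi>_def qpoch_Suc[of \<beta> q i] e(3) power_Suc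
        by (simp add: A_def B_def K_def)
      have G0: "G k = - q * A * (1 - K) * (1 - \<gamma> * B) * (\<phi> * (1 - \<beta> * (A * B * K))) * (c (Suc j) k * c m k)"
        unfolding G_def i A_def[symmetric] B_def[symmetric]
        unfolding K_def[symmetric] \<phi>_def qpoch_Suc[of \<beta> q i] e(3)
        by (simp add: mult_ac)
      have G1: "G (Suc k) = - A * (\<phi> * (1 - \<gamma> * q * (A * B * K))) * (\<gamma> - \<beta> * K) * (1 - B) * (c j k * c m k)"
      proof -
        have "q * (q ^ j / q ^ Suc k) = A"
          using q by (simp add: A_def)
        moreover have "c (Suc j) (Suc k) = c j k"
          by (simp add: c_def)
        ultimately have "G (Suc k) = - A * ((1 - q ^ Suc k) * w (Suc k))
            * (qpoch \<beta> q i / qpoch \<gamma> q (Suc i)) * c j k * ((1 - \<gamma> * (q ^ m / q ^ Suc k)) * c m (Suc k))"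
          unfolding G_def i by (simp add: mult_ac)
        then show ?thesis
          unfolding w_Suc c_Suc' \<phi>[symmetric] by (simp add: K_def B_def)
      qed
      have rec: "(1 - q * A) * c (Suc j) k = (1 - \<gamma> * A) * c j k"
        using c_Suc[of j k] by (simp add: A_def)
      show ?thesis
      proof (cases "k \<le> j")
        case True
        have "q * A = q ^ Suc (j - k)"
          using q True by (simp add: A_def power_diff)
        then have "1 - q * A \<noteq> 0"
          using nq[of "j - k"] by (metis right_minus_eq)
        then show ?thesis
          using wz_step[OF rec, of K \<phi> \<beta> B "c m k"]
          unfolding T0 T1 G0 G1 e(1) power_Suc by simp
      next
        case False
        then have c0: "c j k = 0" by (simp add: c_def)
        show ?thesis
        proof (cases "k = Suc j")
          case True
          \<comment> \<open>the one border term, in which \<open>1 - q * A = 0\<close> and \<open>wz_step\<close> gives nothing\<close>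
          then have qA: "q * A = 1" using q by (simp add: A_def)
          then have e': "q ^ Suc j = K" "\<gamma> * q * A * B = \<gamma> * B" "- q * A = - 1"
            using True by (simp_all add: K_def mult.assoc flip: mult.assoc[of q A B])
          show ?thesis
            unfolding T0 T1 G0 G1 c0 e' by (simp add: algebra_simps)
        next
          case neq: False
          then have "c (Suc j) k = 0" using False by (simp add: c_def)
          then show ?thesis unfolding T0 T1 G0 G1 c0 by simp
        qed
      qed
    qed
    then have "(1 - q ^ Suc j) * S (Suc j) m - (1 - \<beta> * q ^ j) * S j m = (\<Sum>k\<le>m. G (Suc k) - G k)"
      unfolding S_def sum_distrib_left sum_subtractf[symmetric] by (intro sum.cong) auto
    also have "\<dots> = G (Suc m) - G 0"
      by (simp add: lessThan_Suc_atMost[symmetric] sum_lessThan_telescope)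
    also have "\<dots> = 0"
      by (simp add: G_def c_def)
    finally show ?thesis by simp
  qed
  have "S j m = rogers_coeff \<beta> q j * rogers_coeff \<beta> q m"
  proof (induction j)
    case 0
    have "S 0 m = T 0 m 0"
      unfolding S_def by (subst sum.atMost_shift) (simp add: T_def c_def)
    also have "\<dots> = rogers_coeff \<beta> q m"
    proof -
      have "qpoch \<gamma> q m \<noteq> 0" "1 - \<gamma> * q ^ m \<noteq> 0"
        using ng qpoch_nonzero by auto
      then show ?thesis
        by (simp add: T_def c_def w_def rogers_coeff_def qpoch_Suc)
    qed
    finally show ?case by simp
  next
    case (Suc j)
    have "(1 - q ^ Suc j) * S (Suc j) m = (1 - q ^ Suc j) * (rogers_coeff \<beta> q (Suc j) * rogers_coeff \<beta> q m)"
      using step[of j] rogers_coeff_Suc[OF nq, of j \<beta>] Suc.IH by (simp add: mult.assoc)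
    then show ?case using nq[of j] by simp
  qed
  moreover have "S j m = (\<Sum>k\<le>min j m. connection_coeff \<beta> \<gamma> q (j + m) k
        * (rogers_coeff \<gamma> q (j - k) * rogers_coeff \<gamma> q (m - k)))"
    unfolding S_def
  proof (rule sum.mono_neutral_cong_right)
    show "T j m k = connection_coeff \<beta> \<gamma> q (j + m) k
        * (rogers_coeff \<gamma> q (j - k) * rogers_coeff \<gamma> q (m - k))" if "k \<in> {..min j m}" for k
    proof -
      have k: "k \<le> j" "k \<le> m" using that by auto
      then have "j + m - 2 * k = (j - k) + (m - k)"
        by auto
      then have "q ^ (j + m - 2 * k) = (q ^ j / q ^ k) * (q ^ m / q ^ k)"
        using k q by (simp add: power_add power_diff)
      then show ?thesis
        using k by (simp add: T_def c_def w_def connection_coeff_def mult.assoc)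
    qed
  qed (auto simp: T_def c_def)
  ultimately show ?thesis by simp
qed

proposition rogers_form_connection:
  fixes \<beta> \<gamma> q a c :: complex
  assumes "q \<noteq> 0" "\<And>j. q ^ Suc j \<noteq> 1" "\<gamma> \<noteq> 0" "\<And>j. \<gamma> * q ^ j \<noteq> 1"
  shows "rogers_form \<beta> q a c n
    = (\<Sum>k\<le>n div 2. connection_coeff \<beta> \<gamma> q n k * (a * c) ^ k * rogers_form \<gamma> q a c (n - 2 * k))"
proof -
  let ?h = "rogers_coeff \<gamma> q"
  define f where "f j k = connection_coeff \<beta> \<gamma> q n k * (?h (j - k) * ?h (n - j - k)) * c ^ j * a ^ (n - j)" for j k
  have "rogers_form \<beta> q a c n = (\<Sum>j\<le>n. \<Sum>k\<le>min j (n - j). f j k)"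
    unfolding rogers_form_def
  proof (rule sum.cong[OF refl])
    fix j assume "j \<in> {..n}"
    then show "rogers_coeff \<beta> q j * rogers_coeff \<beta> q (n - j) * c ^ j * a ^ (n - j) = (\<Sum>k\<le>min j (n - j). f j k)"
      using rogers_coeff_connection[OF assms, of \<beta> j "n - j"]
      by (simp add: f_def sum_distrib_right)
  qed
  also have "\<dots> = (\<Sum>(j, k)\<in>(SIGMA j:{..n}. {..min j (n - j)}). f j k)"
    by (rule sum.Sigma) auto
  also have "\<dots> = (\<Sum>(k, i)\<in>(SIGMA k:{..n div 2}. {..n - 2 * k}). f (k + i) k)"
    by (rule sum.reindex_bij_witness[of _ "\<lambda>(k, i). (k + i, k)" "\<lambda>(j, k). (k, j - k)"]) auto
  also have "\<dots> = (\<Sum>k\<le>n div 2. \<Sum>i\<le>n - 2 * k. f (k + i) k)"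
    by (rule sum.Sigma[symmetric]) auto
  also have "\<dots> = (\<Sum>k\<le>n div 2. connection_coeff \<beta> \<gamma> q n k * (a * c) ^ k * rogers_form \<gamma> q a c (n - 2 * k))"
  proof (intro sum.cong refl)
    fix k assume k: "k \<in> {..n div 2}"
    have "f (k + i) k = connection_coeff \<beta> \<gamma> q n k * (a * c) ^ k
        * (?h i * ?h (n - 2 * k - i) * c ^ i * a ^ (n - 2 * k - i))" if "i \<le> n - 2 * k" for i
    proof -
      have "n - (k + i) = k + (n - 2 * k - i)" "n - (k + i) - k = n - 2 * k - i"
        using that k by auto
      then show ?thesis
        unfolding f_def by (simp only: power_add power_mult_distrib diff_add_inverse) (simp add: mult_ac)
    qed
    then show "(\<Sum>i\<le>n - 2 * k. f (k + i) k)
      = connection_coeff \<beta> \<gamma> q n k * (a * c) ^ k * rogers_form \<gamma> q a c (n - 2 * k)"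
      unfolding rogers_form_def sum_distrib_left by (intro sum.cong) auto
  qed
  finally show ?thesis .
qed

section \<open>Convergence\<close>

lemma qpoch_convergent:
  assumes "cmod q < 1"
  shows "convergent (qpoch a q)"
proof -
  have "summable (\<lambda>j. norm (- a * q ^ j))"
    using assms by (simp add: norm_mult norm_power summable_mult summable_geometric)
  then have "abs_convergent_prod (\<lambda>j. 1 + - a * q ^ j)"
    using summable_imp_abs_convergent_prod[of "\<lambda>j. 1 + - a * q ^ j"] by simp
  then have "convergent_prod (\<lambda>j. 1 - a * q ^ j)"
    using abs_convergent_prod_imp_convergent_prod by fastforce
  then have "convergent (\<lambda>n. qpoch a q (Suc n))"
    unfolding qpoch_def lessThan_Suc_atMost by (rule convergent_prod_imp_convergent)
  then show ?thesis
    by (simp add: convergent_Suc_iff)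
qed

lemma qpoch_Bseq: "cmod q < 1 \<Longrightarrow> Bseq (qpoch a q)"
  by (intro convergent_imp_Bseq qpoch_convergent)

text \<open>The infinite product converges to a nonzero limit because no factor vanishes.\<close>

lemma qpoch_inverse_Bseq:
  assumes "cmod q < 1" "cmod a < 1"
  shows "Bseq (\<lambda>n. inverse (qpoch a q n))"
proof -
  have "summable (\<lambda>j. norm (- a * q ^ j))"
    using assms by (simp add: norm_mult norm_power summable_mult summable_geometric)
  then have "convergent_prod (\<lambda>j. 1 + - a * q ^ j)"
    using param_power_neq_1[OF assms] by (intro summable_imp_convergent_prod_complex) auto
  then have "convergent_prod (\<lambda>j. 1 - a * q ^ j)" by simp
  then obtain L where L: "(\<lambda>n. qpoch a q (Suc n)) \<longlonglongrightarrow> L" "L \<noteq> 0"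
    using param_power_neq_1[OF assms] unfolding qpoch_def lessThan_Suc_atMost
    by (subst (asm) convergent_prod_iff_nz_lim) auto
  then have "(\<lambda>n. inverse (qpoch a q (Suc n))) \<longlonglongrightarrow> inverse L"
    by (intro tendsto_inverse)
  then have "convergent (\<lambda>n. inverse (qpoch a q (Suc n)))"
    by (auto simp: convergent_def)
  then have "convergent (\<lambda>n. inverse (qpoch a q n))"
    by (subst (asm) convergent_Suc_iff)
  then show ?thesis by (rule convergent_imp_Bseq)
qed

lemma qpoch_ratio_Bseq:
  assumes "cmod q < 1" "cmod b < 1"
  shows "Bseq (\<lambda>n. qpoch a q n / qpoch b q n)"
  using Bseq_mult[OF qpoch_Bseq[OF assms(1), of a] qpoch_inverse_Bseq[OF assms]]
  by (simp add: divide_inverse)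

lemma qpochs_ratio_Bseq:
  assumes q: "cmod q < 1" and "length as = length bs" and "\<And>b. b \<in> set bs \<Longrightarrow> cmod b < 1"
  shows "Bseq (\<lambda>n. qpochs as q n / qpochs bs q n)"
  using assms(2,3)
proof (induction as bs rule: list_induct2)
  case Nil
  then show ?case by (simp add: qpochs_def)
next
  case (Cons a as b bs)
  then show ?case
    using Bseq_mult[OF qpoch_ratio_Bseq[OF q, of b a] Cons.IH] by (simp add: qpochs_def)
qed

lemma summable_norm_qhyp_term:
  assumes q: "cmod q < 1" and len: "length as = Suc (length bs)"
    and bs: "\<And>b. b \<in> set bs \<Longrightarrow> cmod b < 1" and z: "cmod z < 1"
  shows "summable (\<lambda>k. norm (qhyp_term as bs q z k))"
proof -
  have "Bseq (\<lambda>k. qpochs as q k / qpochs (q # bs) q k)"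
    using assms by (intro qpochs_ratio_Bseq) auto
  then obtain B where B: "\<And>k. norm (qpochs as q k / qpochs (q # bs) q k) \<le> B"
    by (auto simp: Bseq_def)
  show ?thesis
  proof (rule summable_comparison_test')
    show "summable (\<lambda>k. B * norm z ^ k)"
      using z by (intro summable_mult summable_geometric) simp
    show "norm (norm (qhyp_term as bs q z k)) \<le> B * norm z ^ k" for k
    proof -
      have "qhyp_term as bs q z k = qpochs as q k / qpochs (q # bs) q k * z ^ k"
        using len by (simp add: qhyp_term_def)
      then have "norm (qhyp_term as bs q z k) = norm (qpochs as q k / qpochs (q # bs) q k) * norm z ^ k"
        by (simp only: norm_mult norm_power)
      then show ?thesis
        using mult_right_mono[OF B[of k] zero_le_power[OF norm_ge_zero[of z], of k]] by simp
    qed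
  qed
qed

lemma rogers_form_bound:
  assumes q: "cmod q < 1" and z: "cmod a = 1" "cmod c = 1"
  shows "\<exists>B. \<forall>n. norm (rogers_form \<gamma> q a c n) \<le> B * real (Suc n)"
proof -
  have "Bseq (rogers_coeff \<gamma> q)"
    unfolding rogers_coeff_def using q by (intro qpoch_ratio_Bseq)
  then obtain B where B: "0 < B" "\<And>k. norm (rogers_coeff \<gamma> q k) \<le> B"
    by (auto simp: Bseq_def)
  have "norm (rogers_form \<gamma> q a c n) \<le> B * B * real (Suc n)" for n
  proof -
    have "norm (rogers_form \<gamma> q a c n) \<le> (\<Sum>k\<le>n. B * B)"
      unfolding rogers_form_def
      by (rule sum_norm_le)
        (use B z in \<open>auto simp: norm_mult norm_power intro!: mult_mono\<close>)
    then show ?thesis by (simp add: mult_ac)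
  qed
  then show ?thesis by blast
qed

text \<open>The bound makes the double series absolutely convergent, so that it may be summed along the lines
  \<open>n + 2 * k = N\<close> or along the rows. Its factor \<open>Suc n\<close> accommodates the growth in \<open>rogers_form_bound\<close>.\<close>

lemma sums_rearrange_by_twos:
  fixes F :: "nat \<Rightarrow> nat \<Rightarrow> complex"
  assumes bound: "\<And>n k. norm (F n k) \<le> C * (real (Suc n) * x ^ n) * y ^ k"
    and x: "0 \<le> x" "x < 1" and y: "0 \<le> y" "y < 1"
    and diag: "(\<lambda>N. \<Sum>k\<le>N div 2. F (N - 2 * k) k) sums S"
  shows "(\<lambda>n. \<Sum>k. F n k) sums S"
proof -
  let ?F = "\<lambda>(n, k). F n k"
  have "(\<lambda>(n, k). C * (real (Suc n) * x ^ n) * y ^ k) summable_on (UNIV \<times> UNIV)"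
  proof (rule summable_on_SigmaI)
    show "((\<lambda>k. (\<lambda>(n, k). C * (real (Suc n) * x ^ n) * y ^ k) (n, k)) has_sum
        C * (real (Suc n) * x ^ n) * (1 / (1 - y))) UNIV" for n
    proof -
      have "((\<lambda>k. y ^ k) has_sum (1 / (1 - y))) UNIV"
        using y by (intro norm_summable_imp_has_sum geometric_sums) (auto simp: summable_geometric)
      then show ?thesis
        by (simp only: prod.case has_sum_cmult_right)
    qed
    have "summable (\<lambda>n. real (Suc n) * x ^ n)"
      using geometric_deriv_sums[of x] x by (auto simp: sums_iff)
    then have "(\<lambda>n. real (Suc n) * x ^ n) summable_on UNIV"
      using x by (intro norm_summable_imp_summable_on) simp
    then show "(\<lambda>n. C * (real (Suc n) * x ^ n) * (1 / (1 - y))) summable_on UNIV"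
      by (intro summable_on_cmult_left summable_on_cmult_right)
    show "0 \<le> (case (n, k) of (n, k) \<Rightarrow> C * (real (Suc n) * x ^ n) * y ^ k)" for n k
      using order_trans[OF norm_ge_zero bound[of n k]] by simp
  qed
  then have "(\<lambda>p. norm (?F p)) summable_on (UNIV \<times> UNIV)"
    by (rule summable_on_comparison_test) (use bound in auto)
  then have summ: "?F summable_on (UNIV \<times> UNIV)"
    by (rule abs_summable_summable)
  define T where "T = infsum ?F (UNIV \<times> UNIV)"
  have T: "(?F has_sum T) (UNIV \<times> UNIV)"
    unfolding T_def using summ by (rule has_sum_infsum)
  have rows: "(F n has_sum (\<Sum>k. F n k)) UNIV" for n
  proof -
    have "F n summable_on UNIV"
      using summable_on_SigmaD1[OF summ, of n] by simp
    then have "(F n has_sum infsum (F n) UNIV) UNIV"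
      by (rule has_sum_infsum)
    then show ?thesis
      using has_sum_imp_sums sums_unique by metis
  qed
  have "((\<lambda>n. \<Sum>k. F n k) has_sum T) UNIV"
    using has_sum_SigmaD[OF T, of "\<lambda>n. \<Sum>k. F n k"] rows by simp
  then have 1: "(\<lambda>n. \<Sum>k. F n k) sums T"
    by (rule has_sum_imp_sums)
  have "((\<lambda>(N, k). F (N - 2 * k) k) has_sum T) (SIGMA N:UNIV. {..N div 2})"
    using T
    by (subst has_sum_reindex_bij_witness[where T = "UNIV \<times> UNIV" and h = ?F and s' = T
          and i = "\<lambda>(n, k). (n + 2 * k, k)" and j = "\<lambda>(N, k). (N - 2 * k, k)"]) auto
  then have "((\<lambda>N. \<Sum>k\<le>N div 2. F (N - 2 * k) k) has_sum T) UNIV"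
    by (rule has_sum_SigmaD) (simp add: has_sum_finite)
  then have "T = S"
    using diag has_sum_imp_sums sums_unique2 by blast
  with 1 show ?thesis by simp
qed

section \<open>The expansion of the product\<close>

theorem theorem9:
  fixes x \<theta> \<beta> \<gamma> :: real and q t b r :: complex
    and U L :: "nat \<Rightarrow> complex list"
  assumes x: "x = cos \<theta>"
    and \<beta>: "\<beta> \<in> {-1<..<1} - {0}"
    and \<gamma>: "\<gamma> \<in> {-1<..<1} - {0}"
    and q: "0 < cmod q" "cmod q < 1"
    and t: "cmod t < min ((1 - \<beta>\<^sup>2) * (1 + sqrt (cmod q) * \<bar>\<beta>\<bar>)) 1"
    and b: "b ^ 2 = complex_of_real \<beta>"  \<comment> \<open>\<open>b = \<beta>\<^bsup>1/2\<^esup>\<close>\<close>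
    and r: "r ^ 4 = q"  \<comment> \<open>\<open>r = q\<^bsup>1/4\<^esup>\<close>, so that \<open>q\<^bsup>m/2\<^esup> = r\<^bsup>2m\<^esup>\<close>\<close>
  defines "U \<equiv> \<lambda>n.
      [\<beta> / \<gamma>, \<beta> * q ^ n,
       \<i> * (b * r ^ (2*n)), - (\<i> * (b * r ^ (2*n))),
       \<i> * (b * r ^ (2*n + 2)), - (\<i> * (b * r ^ (2*n + 2))),
       b * r ^ (2*n + 1), - (b * r ^ (2*n + 1)),
       b * r ^ (2*n + 3), - (b * r ^ (2*n + 3))]"
    and "L \<equiv> \<lambda>n.
      [\<gamma> * q ^ (n + 1),
       \<beta> * r ^ (2*n), - (\<beta> * r ^ (2*n)),
       \<beta> * r ^ (2*n + 2), - (\<beta> * r ^ (2*n + 2)),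
       \<i> * (b * r ^ (2*n + 1)), - (\<i> * (b * r ^ (2*n + 1))),
       \<i> * (b * r ^ (2*n + 3)), - (\<i> * (b * r ^ (2*n + 3)))]"
  shows
    "summable (qhyp_term [b * cis \<theta>, - (r^2 * b * cis \<theta>)] [- (\<beta> * r^2)] q (t * cis (- \<theta>)))
     \<and> summable (qhyp_term [r^2 * b * cis (- \<theta>), - (b * cis (- \<theta>))] [- (\<beta> * r^2)] q (t * cis \<theta>))
     \<and> (\<forall>n. summable (qhyp_term (U n) (L n) q (\<gamma> * t^2)))
     \<and> (\<lambda>n. qpochs [\<beta>, - \<beta>, \<beta> * r^2] q n * t ^ n / qpochs [\<gamma>, \<beta>^2, - (\<beta> * r^2)] q n
           * rogers_C n x \<gamma> q * qhyp (U n) (L n) q (\<gamma> * t^2))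
     sums (qhyp [b * cis \<theta>, - (r^2 * b * cis \<theta>)] [- (\<beta> * r^2)] q (t * cis (- \<theta>))
         * qhyp [r^2 * b * cis (- \<theta>), - (b * cis (- \<theta>))] [- (\<beta> * r^2)] q (t * cis \<theta>))"
proof -
  define z v where "z = cis \<theta>" and "v = cis (- \<theta>)"
  define s where "s = r\<^sup>2"
  define B G where "B = complex_of_real \<beta>" and "G = complex_of_real \<gamma>"
  have zv: "z * v = 1" "cmod z = 1" "cmod v = 1"
    by (simp_all add: z_def v_def cis_mult)
  have s: "q = s\<^sup>2" "s \<noteq> 0" "cmod s < 1"
  proof -
    show "q = s\<^sup>2" using r by (simp add: s_def power_mult[symmetric])
    then show "s \<noteq> 0" using q by auto
    have "(cmod s)\<^sup>2 < 1" using q \<open>q = s\<^sup>2\<close> by (simp add: norm_power)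
    then show "cmod s < 1" by (simp add: power_less_one_iff abs_square_less_1)
  qed
  have q0: "q \<noteq> 0" using q by auto
  have r1: "cmod r < 1"
    using s(3) by (simp add: s_def norm_power abs_square_less_1)
  have bB: "b\<^sup>2 = B" "b \<noteq> 0" "cmod b < 1"
  proof -
    show "b\<^sup>2 = B" using b by (simp add: B_def)
    then show "b \<noteq> 0" using \<beta> by (auto simp: B_def)
    have "(cmod b)\<^sup>2 < 1" using \<beta> b by (simp add: abs_less_iff flip: norm_power)
    then show "cmod b < 1" by (simp add: abs_square_less_1)
  qed
  have B: "cmod B < 1" and G: "G \<noteq> 0" "cmod G < 1"
    using \<beta> \<gamma> by (auto simp: B_def G_def)
  have t1: "cmod t < 1" using t by simp
  have nq: "q ^ Suc j \<noteq> 1" for j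
    using param_power_neq_1[OF q(2) q(2), of j] by simp
  have nG: "G * q ^ j \<noteq> 1" for j
    by (rule param_power_neq_1[OF q(2) G(2)])
  have prod_small: "cmod (y * w) < 1" if "cmod y < 1" "cmod w < 1" for y w :: complex
    using mult_strict_mono'[OF that] by (simp add: norm_mult)
  have small: "cmod (B * s) < 1" "cmod (B\<^sup>2) < 1" "cmod (G * t\<^sup>2) < 1" 
    using prod_small[OF B s(3)] prod_small[OF B B] prod_small[OF G(2) prod_small[OF t1 t1]]
    by (simp_all add: power2_eq_square)
  have nBs: "1 + B * s * q ^ j \<noteq> 0" for j
    using param_power_neq_1[of q "- (B * s)" j] q(2) small(1) by (auto simp: add_eq_0_iff)

  define X Y where "X k = qhyp_term [b * z, - (s * b * z)] [- (B * s)] q (t * v) k"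
    and "Y k = qhyp_term [s * b * v, - (b * v)] [- (B * s)] q (t * z) k" for k
  have X: "summable (\<lambda>k. norm (X k))" and Y: "summable (\<lambda>k. norm (Y k))"
    unfolding X_def Y_def using q small zv t1
    by (auto intro!: summable_norm_qhyp_term simp: norm_mult)

  \<comment> \<open>\<open>F n k\<close> is the part of the term with \<open>t ^ (n + 2 * k)\<close> that is a multiple of \<open>rogers_form G q z v n\<close>\<close>
  define R where "R N = qpoch (- B) q N * qpoch (B * s) q N / (qpoch (B\<^sup>2) q N * qpoch (- (B * s)) q N)" for N
  define F where "F n k = R (n + 2 * k) * t ^ (n + 2 * k) * connection_coeff B G q (n + 2 * k) k
      * rogers_form G q z v n" for n k

  have shift: "n + 2 * k - k = n + k" "n + 2 * k - 2 * k = n" for n k :: nat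
    by simp_all

  have diag: "(\<Sum>i\<le>N. X i * Y (N - i)) = (\<Sum>k\<le>N div 2. F (N - 2 * k) k)" for N
  proof -
    let ?u = "\<lambda>k. pair_coeff (b * z) (- (s * (b * z))) (- (b * z * (b * v) * s)) q k"
    let ?v = "\<lambda>k. pair_coeff (s * (b * v)) (- (b * v)) (- (b * z * (b * v) * s)) q k"
    have ac: "b * z * (b * v) = B"
      using bB(1) zv(1) by (simp add: power2_eq_square mult_ac)
    have XY: "X k = ?u k * (t * v) ^ k" "Y k = ?v k * (t * z) ^ k" for k
      unfolding ac by (simp_all add: X_def Y_def qhyp_term_def qpochs_def pair_coeff_def mult.assoc)
    \<comment> \<open>multiplying by \<open>b ^ N\<close> replaces \<open>z, v\<close> by \<open>b * z, b * v\<close>, whose product is \<open>B\<close>\<close>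
    have "b ^ N * (\<Sum>i\<le>N. X i * Y (N - i)) = t ^ N * cauchy_coeff (\<lambda>k. ?u k * (b * v) ^ k) (\<lambda>k. ?v k * (b * z) ^ k) N"
      unfolding cauchy_coeff_def sum_distrib_left
    proof (rule sum.cong[OF refl])
      fix i assume i: "i \<in> {..N}"
      have "b ^ N = b ^ i * b ^ (N - i)" "t ^ N = t ^ i * t ^ (N - i)"
        using i by (simp_all add: power_add[symmetric])
      then show "b ^ N * (X i * Y (N - i)) = t ^ N * (?u i * (b * v) ^ i * (?v (N - i) * (b * z) ^ (N - i)))"
        by (simp only: XY power_mult_distrib mult_ac)
    qed
    also have "cauchy_coeff (\<lambda>k. ?u k * (b * v) ^ k) (\<lambda>k. ?v k * (b * z) ^ k) N
        = R N * rogers_form B q (b * z) (b * v) N"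
    proof -
      have nz: "qpoch (B\<^sup>2) q N \<noteq> 0" "qpoch (- (B * s)) q N \<noteq> 0"
        using qpoch_nz q(2) small by auto
      then show ?thesis
        using pair_product_eq_rogers_form[of q s "b * z" "b * v" N, OF s(1,2) nq] nBs
        unfolding ac R_def by (simp add: divide_simps mult_ac)
    qed
    also have "rogers_form B q (b * z) (b * v) N = b ^ N * rogers_form B q z v N"
      by (rule rogers_form_scale)
    finally have "(\<Sum>i\<le>N. X i * Y (N - i)) = R N * t ^ N * rogers_form B q z v N"
      using bB(2) by simp
    also have "\<dots> = (\<Sum>k\<le>N div 2. F (N - 2 * k) k)"
      unfolding rogers_form_connection[OF q0 nq G(1) nG, of B z v N] sum_distrib_left
      by (intro sum.cong) (auto simp: F_def zv)
    finally show ?thesis .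
  qed
  have cauchy: "(\<lambda>N. \<Sum>k\<le>N div 2. F (N - 2 * k) k) sums ((\<Sum>k. X k) * (\<Sum>k. Y k))"
    using Cauchy_product_sums[OF X Y] unfolding diag .

  have "\<exists>C. \<forall>n k. norm (F n k) \<le> C * (real (Suc n) * cmod t ^ n) * cmod (G * t\<^sup>2) ^ k"
  proof -
    have "Bseq R"
      using Bseq_mult[OF qpoch_ratio_Bseq[OF q(2), of "B\<^sup>2" "- B"] qpoch_ratio_Bseq[OF q(2), of "- (B * s)" "B * s"]] small
      by (simp add: R_def[abs_def])
    then obtain K1 where K1: "0 < K1" "\<And>N. norm (R N) \<le> K1"
      by (auto simp: Bseq_def)
    obtain K2 where K2: "0 < K2" "\<And>k. norm (qpoch (B / G) q k / qpoch q q k) \<le> K2"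
      using qpoch_ratio_Bseq[OF q(2) q(2), of "B / G"] by (auto simp: Bseq_def)
    obtain K3 where K3: "0 < K3" "\<And>m. norm (qpoch B q m) \<le> K3"
      using qpoch_Bseq[OF q(2), of B] by (auto simp: Bseq_def)
    obtain K4 where K4: "0 < K4" "\<And>m. norm (inverse (qpoch G q m)) \<le> K4"
      using qpoch_inverse_Bseq[OF q(2) G(2)] unfolding Bseq_def by blast
    obtain K5 where K5: "\<And>n. norm (rogers_form G q z v n) \<le> K5 * real (Suc n)"
      using rogers_form_bound[OF q(2) zv(2,3)] by blast
    have "norm (F n k) \<le> (K1 * K2 * K3 * 2 * K4 * K5) * (real (Suc n) * cmod t ^ n) * cmod (G * t\<^sup>2) ^ k" for n k
    proof -
      have one: "norm (1 - G * q ^ n) \<le> 2"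
      proof -
        have "norm (G * q ^ n) \<le> 1 * 1"
          unfolding norm_mult norm_power using G q by (intro mult_mono power_le_one) auto
        then show ?thesis using norm_triangle_ineq4[of 1 "G * q ^ n"] by simp
      qed
      have "F n k = R (n + 2 * k) * (qpoch (B / G) q k / qpoch q q k) * qpoch B q (n + k) * (1 - G * q ^ n)
          * inverse (qpoch G q (Suc (n + k))) * rogers_form G q z v n * (t ^ (n + 2 * k) * G ^ k)"
        unfolding F_def connection_coeff_def shift by (simp add: divide_inverse)
      also have "norm \<dots> \<le> K1 * K2 * K3 * 2 * K4 * (K5 * real (Suc n)) * (cmod t ^ (n + 2 * k) * cmod G ^ k)"
        unfolding norm_mult norm_power
        by (intro mult_mono K1 K2[unfolded norm_mult] K3 K4 K5 one order_refl)
          (use K1(1) K2 K3(1) K4(1) order_trans[OF norm_ge_zero K5] in \<open>auto simp: norm_mult\<close>)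
      also have "\<dots> = (K1 * K2 * K3 * 2 * K4 * K5) * (real (Suc n) * cmod t ^ n) * cmod (G * t\<^sup>2) ^ k"
        by (simp add: norm_mult norm_power power_add power_mult power_mult_distrib)
      finally show ?thesis .
    qed
    then show ?thesis by blast
  qed
  then obtain C where C: "\<And>n k. norm (F n k) \<le> C * (real (Suc n) * cmod t ^ n) * cmod (G * t\<^sup>2) ^ k"
    by blast
  have rows: "(\<lambda>n. \<Sum>k. F n k) sums ((\<Sum>k. X k) * (\<Sum>k. Y k))"
    by (rule sums_rearrange_by_twos[OF C _ t1 _ small(3) cauchy]) auto

  have UL: "summable (\<lambda>k. norm (qhyp_term (U n) (L n) q (G * t\<^sup>2) k))" for n
  proof (rule summable_norm_qhyp_term[OF q(2) _ _ small(3)])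
    show "length (U n) = Suc (length (L n))"
      by (simp add: U_def L_def)
    have pw: "cmod (y * w ^ i) < 1" if "cmod y < 1" "cmod w < 1" for y w :: complex and i
      using that by (metis mult_left_le norm_mult norm_power norm_ge_zero power_le_one less_imp_le order_le_less_trans)
    have norm_ii: "cmod (\<i> * y) = cmod y" for y
      by (simp add: norm_mult)
    show "cmod y < 1" if "y \<in> set (L n)" for y
      using that unfolding L_def list.set insert_iff empty_iff B_def[symmetric] G_def[symmetric]
      by (elim disjE FalseE)
        (simp_all only: norm_minus_cancel norm_ii pw[OF bB(3) r1] pw[OF B r1] pw[OF G(2) q(2)])
  qed

  have row: "(\<Sum>k. F n k) = qpochs [\<beta>, - \<beta>, \<beta> * r^2] q n * t ^ n / qpochs [\<gamma>, \<beta>^2, - (\<beta> * r^2)] q n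
           * rogers_C n x \<gamma> q * qhyp (U n) (L n) q (\<gamma> * t^2)" for n
  proof -
    define c where "c = qpochs [B, - B, B * s] q n * t ^ n / qpochs [G, B\<^sup>2, - (B * s)] q n * rogers_form G q z v n"
    define w where "w = r ^ (2 * n)"
    have w: "q ^ n = w\<^sup>2" "r ^ (2 * n) = w" "r ^ (2 * n + 1) = w * r"
        "r ^ (2 * n + 2) = w * r\<^sup>2" "r ^ (2 * n + 3) = w * r ^ 3"
    proof -
      show "q ^ n = w\<^sup>2"
        by (simp add: w_def r[symmetric] mult.commute flip: power_mult)
    qed (simp_all only: w_def power_add power_one_right)
    have d1: "qpoch (- B) q (n + 2 * k) = qpoch (- B) q n * (qpoch (\<i> * (b * r ^ (2*n))) q k * qpoch (- (\<i> * (b * r ^ (2*n)))) q k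
        * (qpoch (\<i> * (b * r ^ (2*n + 2))) q k * qpoch (- (\<i> * (b * r ^ (2*n + 2)))) q k))" for k
      by (rule qpoch_add_double[OF s(1)])
        (simp_all only: w s_def bB(1)[symmetric],
          simp_all add: power_mult_distrib power2_eq_square power3_eq_cube mult_ac)
    have d2: "qpoch (B * s) q (n + 2 * k) = qpoch (B * s) q n * (qpoch (b * r ^ (2*n + 1)) q k * qpoch (- (b * r ^ (2*n + 1))) q k
        * (qpoch (b * r ^ (2*n + 3)) q k * qpoch (- (b * r ^ (2*n + 3))) q k))" for k
      by (rule qpoch_add_double[OF s(1)])
        (simp_all only: w s_def bB(1)[symmetric],
          simp_all add: power_mult_distrib power2_eq_square power3_eq_cube mult_ac)
    have d3: "qpoch (B\<^sup>2) q (n + 2 * k) = qpoch (B\<^sup>2) q n * (qpoch (B * r ^ (2*n)) q k * qpoch (- (B * r ^ (2*n))) q k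
        * (qpoch (B * r ^ (2*n + 2)) q k * qpoch (- (B * r ^ (2*n + 2))) q k))" for k
      by (rule qpoch_add_double[OF s(1)])
        (simp_all only: w s_def bB(1)[symmetric],
          simp_all add: power_mult_distrib power2_eq_square power3_eq_cube mult_ac)
    have d4: "qpoch (- (B * s)) q (n + 2 * k) = qpoch (- (B * s)) q n * (qpoch (\<i> * (b * r ^ (2*n + 1))) q k * qpoch (- (\<i> * (b * r ^ (2*n + 1)))) q k
        * (qpoch (\<i> * (b * r ^ (2*n + 3))) q k * qpoch (- (\<i> * (b * r ^ (2*n + 3)))) q k))" for k
      by (rule qpoch_add_double[OF s(1)])
        (simp_all only: w s_def bB(1)[symmetric],
          simp_all add: power_mult_distrib power2_eq_square power3_eq_cube mult_ac)
    have conn: "connection_coeff B G q (n + 2 * k) k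
      = qpoch (B / G) q k * G ^ k * (qpoch B q n * qpoch (B * q ^ n) q k)
        / (qpoch q q k * (qpoch G q n * qpoch (G * q ^ (n + 1)) q k))" for k
    proof -
      have "qpoch G q (Suc (n + k)) = qpoch G q n * (1 - G * q ^ n) * qpoch (G * q ^ (n + 1)) q k"
        using qpoch_add[of G q "Suc n" k] by (simp add: qpoch_Suc)
      then show ?thesis
        using nG[of n] unfolding connection_coeff_def shift by (simp add: qpoch_add)
    qed
    have term_eq: "F n k = c * qhyp_term (U n) (L n) q (G * t\<^sup>2) k" for k
    proof -
      have tt: "t ^ (n + 2 * k) = t ^ n * (t\<^sup>2) ^ k"
        by (simp add: power_add power_mult)
      show ?thesis
        unfolding F_def R_def d1 d2 d3 d4 conn tt c_def qhyp_term_def qpochs_def U_def L_def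
          of_real_divide B_def[symmetric] G_def[symmetric]
        by (simp add: power_mult_distrib divide_inverse mult_ac)
    qed
    have "(\<Sum>k. F n k) = c * qhyp (U n) (L n) q (G * t\<^sup>2)"
      unfolding term_eq qhyp_def by (rule suminf_mult[OF summable_norm_cancel[OF UL]])
    also have "rogers_form G q z v n = rogers_C n x \<gamma> q"
      using rogers_C_eq_rogers_form[OF q0 q(2) G, of n \<theta>] by (simp add: x z_def v_def G_def)
    ultimately show ?thesis
      by (simp add: c_def B_def G_def s_def)
  qed
  show ?thesis
    using summable_norm_cancel[OF X] summable_norm_cancel[OF Y] summable_norm_cancel[OF UL] rows
    unfolding row qhyp_def X_def Y_def B_def G_def s_def z_def v_def by simp
qed

end
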